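(* For all positive integers $p$ and $n$, the graph $P_n^p$ is equitably $k$-choosable for every integer $k \geq p+1$.
   Context: $P_n$ is the path on $n$ vertices. For a graph $H$, the power $H^p$ has vertex set $V(H)$, with two distinct vertices adjacent if and only if their distance in $H$ is at most $p$. A $k$-assignment $L$ for a graph $G$ assigns to each vertex $v$ a set $L(v)$ of exactly $k$ colors. A proper $L$-coloring is a proper coloring $f$ with $f(v)\in L(v)$ for every $v$; it is equitable if each color is used on at most $\lceil |V(G)|/k\rceil$ vertices. $G$ is equitably $k$-choosable if it has an equitable $L$-coloring for every $k$-assignment $L$. *)

theory Defs
  imports "Graph_Theory.Graph_Theory"
begin

text \<open>Simple graphs are symmetric loop-free digraphs (locale \<open>pair_graph\<close>): an undirected edge
  \<open>uv\<close> is represented by the two arcs \<open>(u, v)\<close> and \<open>(v, u)\<close>.\<close>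

definition path_graph :: "nat \<Rightarrow> nat pair_pre_digraph" where
  "path_graph n = \<lparr> pverts = {..<n},
     parcs = {(i, j). i < n \<and> j < n \<and> (j = Suc i \<or> i = Suc j)} \<rparr>"

text \<open>The library's shortest-path weight \<open>\<mu>\<close>, taken with unit arc weights; it is \<open>\<infinity>\<close> if there is
  no walk from \<open>u\<close> to \<open>v\<close>.\<close>

definition graph_dist :: "'a pair_pre_digraph \<Rightarrow> 'a \<Rightarrow> 'a \<Rightarrow> ereal" where
  "graph_dist H u v = wf_digraph.\<mu> (with_proj H) (\<lambda>_. 1) u v"

definition graph_power :: "'a pair_pre_digraph \<Rightarrow> nat \<Rightarrow> 'a pair_pre_digraph" where
  "graph_power H p = \<lparr> pverts = pverts H,
     parcs = {(u, v). u \<in> pverts H \<and> v \<in> pverts H \<and> u \<noteq> v \<and> graph_dist H u v \<le> ereal (real p)} \<rparr>"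

definition k_assignment :: "'a pair_pre_digraph \<Rightarrow> nat \<Rightarrow> ('a \<Rightarrow> 'c set) \<Rightarrow> bool" where
  "k_assignment G k L \<longleftrightarrow> (\<forall>v\<in>pverts G. finite (L v) \<and> card (L v) = k)"

definition proper_coloring :: "'a pair_pre_digraph \<Rightarrow> ('a \<Rightarrow> 'c) \<Rightarrow> bool" where
  "proper_coloring G f \<longleftrightarrow> (\<forall>(u, v)\<in>parcs G. f u \<noteq> f v)"

definition proper_L_coloring :: "'a pair_pre_digraph \<Rightarrow> ('a \<Rightarrow> 'c set) \<Rightarrow> ('a \<Rightarrow> 'c) \<Rightarrow> bool" where
  "proper_L_coloring G L f \<longleftrightarrow> proper_coloring G f \<and> (\<forall>v\<in>pverts G. f v \<in> L v)"

definition equitable :: "'a pair_pre_digraph \<Rightarrow> nat \<Rightarrow> ('a \<Rightarrow> 'c) \<Rightarrow> bool" where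
  "equitable G k f \<longleftrightarrow>
     (\<forall>c. int (card {v \<in> pverts G. f v = c}) \<le> \<lceil>real (card (pverts G)) / real k\<rceil>)"

text \<open>The type argument fixes the universe from which the colors are drawn.\<close>

definition equitably_choosable :: "'c itself \<Rightarrow> nat \<Rightarrow> 'a pair_pre_digraph \<Rightarrow> bool" where
  "equitably_choosable _ k G \<longleftrightarrow>
     (\<forall>L :: 'a \<Rightarrow> 'c set. k_assignment G k L \<longrightarrow>
        (\<exists>f. proper_L_coloring G L f \<and> equitable G k f))"

lemma pair_graph_path_graph: "pair_graph (path_graph n)"
proof
  have "parcs (path_graph n) \<subseteq> {..<n} \<times> {..<n}"
    by (auto simp: path_graph_def)
  then show "finite (parcs (path_graph n))"
    by (rule finite_subset) simp
  show "symmetric (with_proj (path_graph n))"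
    by (auto simp: symmetric_def path_graph_def intro!: symI)
qed (auto simp: path_graph_def)

lemma (in pair_graph) graph_dist_sym: "graph_dist G u v = graph_dist G v u"
proof -
  have rev: "awalk v (rev (map prod.swap q)) u \<and>
      awalk_cost (\<lambda>_. 1) (rev (map prod.swap q)) = awalk_cost (\<lambda>_. 1) q"
    if "awalk u q v" for u q v
    using that
  proof (induction q arbitrary: u)
    case Nil
    then show ?case by (auto simp: awalk_Nil_iff)
  next
    case (Cons e q)
    obtain x y where e: "e = (x, y)" by (cases e)
    have *: "x = u" "(x, y) \<in> parcs G" "awalk y q v"
      using Cons.prems by (auto simp: awalk_Cons_iff e)
    have "(y, x) \<in> parcs G"
      using *(2) sym_arcs by (auto simp: symmetric_def dest: symD)
    then have "awalk y [(y, x)] x"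
      by (simp add: awalk_Cons_iff awalk_Nil_iff in_arcsD1 in_arcsD2)
    with Cons.IH[OF *(3)] * show ?case
      by (auto simp: e intro: awalk_appendI)
  qed
  have "graph_dist G v u \<le> graph_dist G u v" for u v
    unfolding graph_dist_def \<mu>_def
    by (intro INF_greatest) (metis INF_lower mem_Collect_eq rev)
  then show ?thesis by (simp add: antisym)
qed

lemma (in pair_graph) pair_graph_graph_power: "pair_graph (graph_power G p)"
proof
  have "parcs (graph_power G p) \<subseteq> pverts G \<times> pverts G"
    by (auto simp: graph_power_def)
  then show "finite (parcs (graph_power G p))"
    by (rule finite_subset) (simp add: pair_finite_verts)
  show "symmetric (with_proj (graph_power G p))"
    by (auto simp: symmetric_def graph_power_def graph_dist_sym intro!: symI)
qed (auto simp: graph_power_def pair_finite_verts)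

end

(* Since k > p, it suffices to color greedily from left to right so that any two vertices less
   than k apart get different colors: at most k - 1 colors are ever forbidden. Each block
   {q k, ..., q k + k - 1} is then rainbow, and the path meets only \<lceil>n / k\<rceil> blocks. *)
theory Submission
  imports Defs
begin

text \<open>Vertices are coloured in increasing order. The earlier \<open>R\<close>-neighbours of a
  vertex occupy at most as many colours as there are such neighbours, so its larger list still
  offers a free one. Recolouring \<open>n\<close> leaves all constraints among smaller vertices
  intact.\<close>

lemma greedy_list_coloring:
  fixes L :: "nat \<Rightarrow> 'c set" and R :: "nat \<Rightarrow> nat \<Rightarrow> bool"
  assumes "\<And>v. v < n \<Longrightarrow> card {u. u < v \<and> R u v} < card (L v)"
  shows "\<exists>f. \<forall>v<n. f v \<in> L v \<and> (\<forall>u<v. R u v \<longrightarrow> f u \<noteq> f v)"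
  using assms
proof (induction n)
  case 0
  then show ?case by simp
next
  case (Suc n)
  then obtain f where f: "\<forall>v<n. f v \<in> L v \<and> (\<forall>u<v. R u v \<longrightarrow> f u \<noteq> f v)"
    by (metis less_SucI)
  let ?U = "{u. u < n \<and> R u n}"
  have "card (f ` ?U) \<le> card ?U"
    by (rule card_image_le) simp
  also have "\<dots> < card (L n)"
    using Suc.prems by simp
  finally have "\<not> L n \<subseteq> f ` ?U"
    by (auto dest!: card_mono[rotated])
  then obtain c where "c \<in> L n" "c \<notin> f ` ?U"
    by blast
  with f have "\<forall>v<Suc n. (f(n := c)) v \<in> L v \<and>
      (\<forall>u<v. R u v \<longrightarrow> (f(n := c)) u \<noteq> (f(n := c)) v)"
    by (auto simp: less_Suc_eq)
  then show ?case by blast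
qed

text \<open>Every arc changes the index by exactly 1, so the triangle inequality bounds the cost of
  each walk, and hence the infimum. If there is no walk, the infimum is \<infinity>; this covers
  indices outside the path.\<close>

lemma path_graph_dist_ge: "ereal \<bar>real u - real v\<bar> \<le> graph_dist (path_graph n) u v"
proof -
  interpret pair_graph "path_graph n"
    by (rule pair_graph_path_graph)
  have "\<bar>real u - real v\<bar> \<le> awalk_cost (\<lambda>_. 1) q" if "awalk u q v" for q
    using that
  proof (induction q arbitrary: u)
    case Nil
    then show ?case by (simp add: awalk_Nil_iff)
  next
    case (Cons e q)
    obtain x y where e: "e = (x, y)" by (cases e)
    have "x = u" "(x, y) \<in> parcs (path_graph n)" "awalk y q v"
      using Cons.prems by (auto simp: awalk_Cons_iff e)
    moreover from this have "\<bar>real u - real y\<bar> = 1"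
      by (auto simp: path_graph_def)
    ultimately show ?case
      using Cons.IH[of y] by (simp add: e)
  qed
  then show ?thesis
    unfolding graph_dist_def \<mu>_def by (intro INF_greatest) simp
qed

lemma graph_power_path_graph_arcD:
  assumes "(u, v) \<in> parcs (graph_power (path_graph n) p)"
  shows "u < n" "v < n" "u \<noteq> v" "\<bar>real u - real v\<bar> \<le> real p"
proof -
  show "u < n" "v < n" "u \<noteq> v"
    using assms by (auto simp: graph_power_def path_graph_def)
  have "graph_dist (path_graph n) u v \<le> ereal (real p)"
    using assms by (simp add: graph_power_def)
  with path_graph_dist_ge have "ereal \<bar>real u - real v\<bar> \<le> ereal (real p)"
    by (rule order_trans)
  then show "\<bar>real u - real v\<bar> \<le> real p" by simp
qed

text \<open>The map \<open>v div k\<close> sends a vertex to its block. Vertices of one block are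
  less than \<open>k\<close> apart, so a colour class meets each block at most once.\<close>

lemma card_color_class_le:
  fixes f :: "nat \<Rightarrow> 'c"
  assumes "k > 0" and f: "\<And>u v. u < v \<Longrightarrow> v < n \<Longrightarrow> v < u + k \<Longrightarrow> f u \<noteq> f v"
  shows "int (card {v. v < n \<and> f v = c}) \<le> \<lceil>real n / real k\<rceil>"
proof -
  let ?C = "{v. v < n \<and> f v = c}"
  \<comment> \<open>No order between \<open>u\<close> and \<open>v\<close> is fixed, so the bound
    serves both cases of the injectivity argument.\<close>
  have less: "v < u + k" if "u div k = v div k" for u v
  proof -
    have "v = u div k * k + v mod k" "u = u div k * k + u mod k"
      using that by (metis div_mult_mod_eq)+
    then show ?thesis
      using mod_less_divisor[OF \<open>k > 0\<close>, of v] by linarith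
  qed
  have "inj_on (\<lambda>v. v div k) ?C"
  proof (rule inj_onI)
    fix u v assume "u \<in> ?C" "v \<in> ?C" and eq: "u div k = v div k"
    then show "u = v"
      using less[OF eq] less[OF eq[symmetric]] f[of u v] f[of v u]
      by (cases u v rule: linorder_cases) auto
  qed
  moreover have "(\<lambda>v. v div k) ` ?C \<subseteq> {..<nat \<lceil>real n / real k\<rceil>}"
  proof clarsimp
    fix v assume "v < n"
    have "real (v div k) \<le> real v / real k"
      by (rule of_nat_div_le_of_nat)
    \<comment> \<open>Strictness here keeps the block index, which starts at 0, below the ceiling
      even when \<open>k\<close> divides \<open>n\<close>.\<close>
    also have "\<dots> < real n / real k"
      using \<open>v < n\<close> \<open>k > 0\<close> by (simp add: divide_strict_right_mono)
    finally have "int (v div k) < \<lceil>real n / real k\<rceil>"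
      by (simp add: less_ceiling_iff)
    then show "v div k < nat \<lceil>real n / real k\<rceil>" by linarith
  qed
  ultimately have "card ?C \<le> nat \<lceil>real n / real k\<rceil>"
    by (metis card_inj_on_le card_lessThan finite_lessThan)
  moreover have "0 \<le> \<lceil>real n / real k\<rceil>"
    unfolding zero_le_ceiling by (rule less_le_trans[of _ 0]) simp_all
  ultimately show ?thesis by linarith
qed

theorem theorem10:
  fixes p n k :: nat
  assumes "p \<ge> 1" and "n \<ge> 1" and "k \<ge> p + 1"
  shows "equitably_choosable TYPE('c) k (graph_power (path_graph n) p)"
  unfolding equitably_choosable_def
proof (intro allI impI)
  fix L :: "nat \<Rightarrow> 'c set"
  let ?G = "graph_power (path_graph n) p"
  have verts: "pverts ?G = {..<n}"
    by (simp add: graph_power_def path_graph_def)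
  assume L: "k_assignment ?G k L"
  have "card {u. u < v \<and> v < u + k} < card (L v)" if "v < n" for v
  proof -
    \<comment> \<open>Truncated subtraction shortens this window near the left end of the path; it
      never has more than \<open>k - 1\<close> elements.\<close>
    have "card {u. u < v \<and> v < u + k} \<le> card {v - (k - 1)..<v}"
      by (rule card_mono) auto
    also have "\<dots> < k"
      using assms by simp
    finally show ?thesis
      using L that by (simp add: k_assignment_def verts)
  qed
  \<comment> \<open>The conflict relation uses \<open>k\<close> instead of \<open>p\<close>: as
    \<open>p < k\<close>, it contains all edges, and it also makes every block rainbow.\<close>
  then obtain f where f: "\<forall>v<n. f v \<in> L v \<and> (\<forall>u<v. v < u + k \<longrightarrow> f u \<noteq> f v)"
    using greedy_list_coloring[of n "\<lambda>u v. v < u + k" L] by blast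
  have "proper_coloring ?G f"
    unfolding proper_coloring_def
  proof clarify
    fix u v assume uv: "(u, v) \<in> parcs ?G" and eq: "f u = f v"
    have "v < u + k" "u < v + k"
      using graph_power_path_graph_arcD(4)[OF uv] assms by linarith+
    then show False
      using f eq graph_power_path_graph_arcD(1-3)[OF uv] by (metis linorder_neqE_nat)
  qed
  moreover have "equitable ?G k f"
    unfolding equitable_def using card_color_class_le[of k n f] f assms by (simp add: verts)
  ultimately show "\<exists>f. proper_L_coloring ?G L f \<and> equitable ?G k f"
    using f by (auto simp: proper_L_coloring_def verts)
qed

end
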